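(* Let $d$ be even and let $f$ be a homogeneous $n$-variate polynomial of degree $d$ with non-negative coefficients, written uniquely as $f=\sum_{\alpha\in\mathbb{N}^n,\ |\alpha|\le d/2}f_{2\alpha}(x)\,x^{2\alpha}$ with each $f_{2\alpha}$ homogeneous multilinear of degree $d-2|\alpha|$. Then \[\frac{\Lambda(f)}{\|f\|_2}\le2^{O(d)}\max_{\alpha\in\mathbb{N}^n,\ |\alpha|\le d/2}\frac{\Lambda(f_{2\alpha})}{\|f_{2\alpha}\|_2}.\]
   Context: $\|h\|_2:=\sup_{\|x\|_2=1}|h(x)|$. For $\alpha\in\mathbb{N}^n$, $|\alpha|=\sum_i\alpha_i$, $x^\alpha=\prod_ix_i^{\alpha_i}$. Multilinear means every monomial with non-zero coefficient has all exponents at most 1. For a homogeneous $h$ of even degree $t$, a matrix representation is a symmetric $M\in\mathbb{R}^{[n]^{t/2}\times[n]^{t/2}}$ with $(x^{\otimes t/2})^TMx^{\otimes t/2}=h(x)$ for all $x$, and $\Lambda(h):=\inf\{\sup_{\|z\|_2=1}z^TMz:\ M\text{ a matrix representation of }h\}$ (for constant $h$, $\Lambda(h)=h$). *)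

theory Defs
  imports "HOL-Analysis.Analysis" "HOL-Library.Poly_Mapping"
begin

text \<open>
  The dimension \<open>n\<close> must be quantified inside the statement, below the constant hidden in
  \<open>2\<^sup>O\<^sup>(\<^sup>d\<^sup>)\<close>. Variables are therefore numbered by \<open>i < n\<close>; an exponent vector is a finitely
  supported \<open>nat \<Rightarrow>\<^sub>0 nat\<close>, a polynomial is the finitely supported family of its coefficients,
  and a point of \<open>n\<close>-space is a function \<open>nat \<Rightarrow> real\<close> of which only the values below \<open>n\<close> matter.
\<close>

type_synonym monom = "nat \<Rightarrow>\<^sub>0 nat"
type_synonym mpoly = "monom \<Rightarrow>\<^sub>0 real"

definition mdeg :: "monom \<Rightarrow> nat" where
  "mdeg m = (\<Sum>i\<in>Poly_Mapping.keys m. Poly_Mapping.lookup m i)"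

definition exponents :: "nat \<Rightarrow> nat \<Rightarrow> monom set" where
  "exponents n k = {\<alpha>. Poly_Mapping.keys \<alpha> \<subseteq> {..<n} \<and> mdeg \<alpha> \<le> k}"

definition eval_poly :: "(nat \<Rightarrow> real) \<Rightarrow> mpoly \<Rightarrow> real" where
  "eval_poly x h =
     (\<Sum>m\<in>Poly_Mapping.keys h.
        Poly_Mapping.lookup h m *
        (\<Prod>i\<in>Poly_Mapping.keys m. x i ^ Poly_Mapping.lookup m i))"

definition homogeneous :: "nat \<Rightarrow> nat \<Rightarrow> mpoly \<Rightarrow> bool" where
  "homogeneous n t h \<longleftrightarrow>
     (\<forall>m\<in>Poly_Mapping.keys h. Poly_Mapping.keys m \<subseteq> {..<n} \<and> mdeg m = t)"

definition multilinear :: "mpoly \<Rightarrow> bool" where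
  "multilinear h \<longleftrightarrow> (\<forall>m\<in>Poly_Mapping.keys h. \<forall>i. Poly_Mapping.lookup m i \<le> 1)"

definition sphere_norm :: "nat \<Rightarrow> mpoly \<Rightarrow> real" where
  "sphere_norm n h = (SUP x\<in>{x. L2_set x {..<n} = 1}. \<bar>eval_poly x h\<bar>)"

definition tuples :: "nat \<Rightarrow> nat \<Rightarrow> nat list set" where
  "tuples n k = {I. set I \<subseteq> {..<n} \<and> length I = k}"

definition tensor_power :: "(nat \<Rightarrow> real) \<Rightarrow> nat list \<Rightarrow> real" where
  "tensor_power x I = (\<Prod>i\<leftarrow>I. x i)"

definition quad_form ::
  "nat list set \<Rightarrow> (nat list \<Rightarrow> nat list \<Rightarrow> real) \<Rightarrow> (nat list \<Rightarrow> real) \<Rightarrow> real" where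
  "quad_form A M z = (\<Sum>I\<in>A. \<Sum>J\<in>A. z I * M I J * z J)"

definition matrix_rep ::
  "nat \<Rightarrow> nat \<Rightarrow> mpoly \<Rightarrow> (nat list \<Rightarrow> nat list \<Rightarrow> real) \<Rightarrow> bool" where
  "matrix_rep n t h M \<longleftrightarrow>
     (\<forall>I\<in>tuples n (t div 2). \<forall>J\<in>tuples n (t div 2). M I J = M J I) \<and>
     (\<forall>x. quad_form (tuples n (t div 2)) M (tensor_power x) = eval_poly x h)"

text \<open>
  The degree \<open>t\<close> is a parameter because the zero polynomial is homogeneous of every degree.
  For \<open>t = 0\<close> the only index is the empty tuple, the only matrix representation of a constant is
  the constant itself, and the infimum is that constant.
  For \<open>h = 0\<close> and \<open>n > 0\<close> both \<open>Lam n t h\<close> and \<open>sphere_norm n h\<close> are \<open>0\<close>, so their quotient is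
  \<open>0\<close>; for a nonzero homogeneous \<open>h\<close> of even degree with nonnegative coefficients the quotient is
  at least \<open>1\<close>. Vanishing terms therefore never decide a maximum of
  such quotients unless all of them vanish.
\<close>

definition Lam :: "nat \<Rightarrow> nat \<Rightarrow> mpoly \<Rightarrow> real" where
  "Lam n t h =
     (INF M\<in>{M. matrix_rep n t h M}.
        SUP z\<in>{z. L2_set z (tuples n (t div 2)) = 1}. quad_form (tuples n (t div 2)) M z)"

text \<open>
  \<open>F \<alpha>\<close> plays the role of \<open>f\<^sub>2\<^sub>\<alpha>\<close>;
  \<open>Poly_Mapping.single (\<alpha> + \<alpha>) 1\<close> is the monomial with exponent vector \<open>2\<alpha>\<close>.
\<close>

definition multilinear_decomposition ::
  "nat \<Rightarrow> nat \<Rightarrow> mpoly \<Rightarrow> (monom \<Rightarrow> mpoly) \<Rightarrow> bool" where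
  "multilinear_decomposition n d f F \<longleftrightarrow>
     (\<forall>\<alpha>\<in>exponents n (d div 2). homogeneous n (d - 2 * mdeg \<alpha>) (F \<alpha>) \<and> multilinear (F \<alpha>)) \<and>
     f = (\<Sum>\<alpha>\<in>exponents n (d div 2). F \<alpha> * Poly_Mapping.single (\<alpha> + \<alpha>) 1)"

end

theory Submission
  imports Defs "HOL-Combinatorics.Multiset_Permutations"
begin

text \<open>
  Write \<open>O(\<alpha>)\<close> for the set of orderings of \<open>\<alpha>\<close>, of size \<open>|\<alpha>|!/\<alpha>!\<close>.
  For the upper bound on \<open>\<Lambda>(f)\<close>, put near-optimal representations of \<open>f\<^sub>2\<^sub>\<alpha>\<close>, divided by
  \<open>|O(\<alpha>)|\<close>, on the diagonal blocks indexed by the tuples \<open>K \<in> O(\<alpha>)\<close> filling the last \<open>|\<alpha>|\<close>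
  positions. For fixed \<open>|\<alpha>| = k\<close> the resulting matrix is block diagonal, hence its largest eigenvalue
  is about \<open>max \<Lambda>(f\<^sub>2\<^sub>\<alpha>)/|O(\<alpha>)|\<close>, and only the \<open>d/2 + 1\<close> values of \<open>k\<close> have to be summed.
  For the lower bound on the norm, evaluate \<open>f\<close> at \<open>|x| + y\<close> with \<open>x\<close> a unit vector and
  \<open>y\<^sub>i = sqrt (\<alpha>\<^sub>i/|\<alpha>|)\<close>: as the coefficients are nonnegative, this is at least
  \<open>f\<^sub>2\<^sub>\<alpha>(|x|) y\<^sup>2\<^sup>\<alpha>\<close>, and \<open>y\<^sup>2\<^sup>\<alpha>\<close> is at least \<open>4\<^sup>-\<^sup>k/|O(\<alpha>)|\<close>
  because \<open>k\<^sup>k \<le> 4\<^sup>k k!\<close>. The factors \<open>|O(\<alpha>)|\<close> cancel.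
\<close>

section \<open>Monomials and polynomials\<close>

definition mono_val :: "(nat \<Rightarrow> real) \<Rightarrow> monom \<Rightarrow> real" where
  "mono_val x m = (\<Prod>i\<in>Poly_Mapping.keys m. x i ^ Poly_Mapping.lookup m i)"

lemma mono_val_superset:
  assumes "finite S" "Poly_Mapping.keys m \<subseteq> S"
  shows "mono_val x m = (\<Prod>i\<in>S. x i ^ Poly_Mapping.lookup m i)"
  unfolding mono_val_def using assms
  by (intro prod.mono_neutral_left) (auto simp: in_keys_iff)

lemma mono_val_zero [simp]: "mono_val x 0 = 1"
  by (simp add: mono_val_def)

lemma mono_val_add: "mono_val x (a + b) = mono_val x a * mono_val x b"
proof -
  let ?S = "Poly_Mapping.keys a \<union> Poly_Mapping.keys b"
  have "Poly_Mapping.keys (a + b) \<subseteq> ?S" by (rule Poly_Mapping.keys_add)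
  then show ?thesis
    by (simp add: mono_val_superset[of ?S] lookup_add power_add prod.distrib)
qed

lemma mono_val_single: "mono_val x (Poly_Mapping.single i k) = x i ^ k"
  by (cases "k = 0") (simp_all add: mono_val_def)

lemma mono_val_nonneg: "(\<And>i. 0 \<le> x i) \<Longrightarrow> 0 \<le> mono_val x m"
  by (simp add: mono_val_def prod_nonneg)

lemma mono_val_mono: "(\<And>i. 0 \<le> x i) \<Longrightarrow> (\<And>i. x i \<le> y i) \<Longrightarrow> mono_val x m \<le> mono_val y m"
  by (auto simp: mono_val_def intro!: prod_mono power_mono)

lemma abs_mono_val: "\<bar>mono_val x m\<bar> = mono_val (\<lambda>i. \<bar>x i\<bar>) m"
  by (simp add: mono_val_def abs_prod power_abs)

lemma mdeg_superset:
  assumes "finite S" "Poly_Mapping.keys m \<subseteq> S"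
  shows "mdeg m = (\<Sum>i\<in>S. Poly_Mapping.lookup m i)"
  unfolding mdeg_def using assms
  by (intro sum.mono_neutral_left) (auto simp: in_keys_iff)

lemma mdeg_add: "mdeg (a + b) = mdeg a + mdeg b"
proof -
  let ?S = "Poly_Mapping.keys a \<union> Poly_Mapping.keys b"
  have "Poly_Mapping.keys (a + b) \<subseteq> ?S" by (rule Poly_Mapping.keys_add)
  then show ?thesis
    by (simp add: mdeg_superset[of ?S] lookup_add sum.distrib)
qed

lemma mono_val_scale: "mono_val (\<lambda>i. c * x i) m = c ^ mdeg m * mono_val x m"
  by (simp add: mono_val_def mdeg_def power_mult_distrib prod.distrib power_sum)

text \<open>Commutative image of a word of indices. Matrix rows and columns are indexed by words,
  coefficients by exponent vectors; \<open>exps\<close> translates between them, and its fibres are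
  the sets of orderings.\<close>

primrec exps :: "nat list \<Rightarrow> monom" where
  "exps [] = 0"
| "exps (i # K) = Poly_Mapping.single i 1 + exps K"

lemma lookup_exps: "Poly_Mapping.lookup (exps K) i = count (mset K) i"
  by (induction K) (auto simp: lookup_add lookup_single)

lemma keys_exps: "Poly_Mapping.keys (exps K) = set K"
  by (auto simp: in_keys_iff lookup_exps count_eq_zero_iff)

lemma mono_val_exps: "mono_val x (exps K) = tensor_power x K"
  by (induction K) (simp_all add: tensor_power_def mono_val_add mono_val_single)

lemma mdeg_exps: "mdeg (exps K) = length K"
  by (induction K) (simp_all add: mdeg_add, simp_all add: mdeg_def)

lemma exps_append: "exps (I @ J) = exps I + exps J"
  by (induction I) (simp_all add: add.assoc)

lemma exps_eq_iff: "exps I = exps J \<longleftrightarrow> mset I = mset J"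
  by (simp add: poly_mapping_eq_iff fun_eq_iff lookup_exps multiset_eq_iff)

lemma ex_exps: "\<exists>K. exps K = m"
proof -
  have "finite {i. 0 < Poly_Mapping.lookup m i}"
    using finite_keys[of m] by (simp add: keys.rep_eq)
  then have c: "count (Abs_multiset (Poly_Mapping.lookup m)) = Poly_Mapping.lookup m"
    by (rule count_Abs_multiset)
  obtain K where "mset K = Abs_multiset (Poly_Mapping.lookup m)"
    using ex_mset by blast
  then have "exps K = m"
    by (intro poly_mapping_eqI) (simp add: lookup_exps c)
  then show ?thesis ..
qed

lemma eval_poly_mono_val:
  "eval_poly x h = (\<Sum>m\<in>Poly_Mapping.keys h. Poly_Mapping.lookup h m * mono_val x m)"
  by (simp add: eval_poly_def mono_val_def)

lemma eval_poly_superset: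
  assumes "finite S" "Poly_Mapping.keys h \<subseteq> S"
  shows "eval_poly x h = (\<Sum>m\<in>S. Poly_Mapping.lookup h m * mono_val x m)"
  unfolding eval_poly_mono_val using assms
  by (intro sum.mono_neutral_left) (auto simp: in_keys_iff)

lemma eval_poly_zero [simp]: "eval_poly x 0 = 0"
  by (simp add: eval_poly_def)

lemma eval_poly_add: "eval_poly x (p + q) = eval_poly x p + eval_poly x q"
proof -
  let ?S = "Poly_Mapping.keys p \<union> Poly_Mapping.keys q"
  have "Poly_Mapping.keys (p + q) \<subseteq> ?S" by (rule Poly_Mapping.keys_add)
  then show ?thesis
    by (simp add: eval_poly_superset[of ?S] lookup_add distrib_right sum.distrib)
qed

lemma eval_poly_sum: "eval_poly x (\<Sum>a\<in>A. p a) = (\<Sum>a\<in>A. eval_poly x (p a))"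
  by (induction A rule: infinite_finite_induct) (simp_all add: eval_poly_add)

lemma eval_poly_single: "eval_poly x (Poly_Mapping.single m c) = c * mono_val x m"
  by (cases "c = 0") (simp_all add: eval_poly_mono_val)

lemma poly_as_sum:
  "p = (\<Sum>m\<in>Poly_Mapping.keys p. Poly_Mapping.single m (Poly_Mapping.lookup p m))"
  for p :: mpoly
  by (intro poly_mapping_eqI)
     (auto simp: lookup_sum lookup_single when_def in_keys_iff)

lemma times_monomial:
  "p * Poly_Mapping.single a 1 =
     (\<Sum>m\<in>Poly_Mapping.keys p. Poly_Mapping.single (m + a) (Poly_Mapping.lookup p m))"
  for p :: mpoly
  by (subst poly_as_sum) (simp add: sum_distrib_right mult_single)

lemma eval_poly_times_monomial:
  "eval_poly x (p * Poly_Mapping.single a 1) = eval_poly x p * mono_val x a"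
  by (simp add: times_monomial eval_poly_sum eval_poly_single mono_val_add
      eval_poly_mono_val[of x p] sum_distrib_right mult.assoc)

lemma lookup_times_monomial:
  "Poly_Mapping.lookup (p * Poly_Mapping.single a 1) \<mu> =
     (\<Sum>m\<in>Poly_Mapping.keys p. Poly_Mapping.lookup p m when m + a = \<mu>)"
  for p :: mpoly
  by (simp add: times_monomial lookup_sum lookup_single)

lemma eval_poly_scale:
  "homogeneous n t h \<Longrightarrow> eval_poly (\<lambda>i. c * x i) h = c ^ t * eval_poly x h"
  by (auto simp: eval_poly_mono_val mono_val_scale homogeneous_def sum_distrib_left mult_ac
      intro!: sum.cong)

definition nonneg_coeffs :: "mpoly \<Rightarrow> bool" where
  "nonneg_coeffs h \<longleftrightarrow> (\<forall>m. 0 \<le> Poly_Mapping.lookup h m)"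

lemma eval_poly_mono:
  "nonneg_coeffs h \<Longrightarrow> (\<And>i. 0 \<le> x i) \<Longrightarrow> (\<And>i. x i \<le> y i) \<Longrightarrow> eval_poly x h \<le> eval_poly y h"
  by (auto simp: eval_poly_mono_val nonneg_coeffs_def
      intro!: sum_mono mult_left_mono mono_val_mono)

lemma eval_poly_nonneg: "nonneg_coeffs h \<Longrightarrow> (\<And>i. 0 \<le> x i) \<Longrightarrow> 0 \<le> eval_poly x h"
  by (auto simp: eval_poly_mono_val nonneg_coeffs_def intro!: sum_nonneg mult_nonneg_nonneg mono_val_nonneg)

lemma abs_eval_poly_le: "nonneg_coeffs h \<Longrightarrow> \<bar>eval_poly x h\<bar> \<le> eval_poly (\<lambda>i. \<bar>x i\<bar>) h"
  unfolding eval_poly_mono_val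
  by (rule order.trans[OF sum_abs])
     (simp add: abs_mult abs_mono_val nonneg_coeffs_def)

section \<open>Index tuples and the orderings of an exponent vector\<close>

lemma finite_tuples [simp]: "finite (tuples n k)"
proof -
  have "tuples n k = {I. set I \<subseteq> {..<n} \<and> length I = k}" by (simp add: tuples_def)
  then show ?thesis by (simp add: finite_lists_length_eq)
qed

lemma exps_in_exponents: "K \<in> tuples n k \<Longrightarrow> k \<le> l \<Longrightarrow> exps K \<in> exponents n l"
  by (simp add: tuples_def exponents_def keys_exps mdeg_exps)

lemma exponents_eq: "exponents n l = (\<Union>k\<le>l. exps ` tuples n k)"
proof (intro equalityI subsetI)
  fix m assume m: "m \<in> exponents n l"
  obtain K where "exps K = m" using ex_exps by blast
  with m show "m \<in> (\<Union>k\<le>l. exps ` tuples n k)"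
    by (force simp: exponents_def tuples_def keys_exps mdeg_exps)
qed (auto intro: exps_in_exponents)

lemma finite_exponents [simp]: "finite (exponents n l)"
  by (simp add: exponents_eq)

lemma zero_in_exponents [simp]: "0 \<in> exponents n l"
  by (simp add: exponents_def mdeg_def)

definition orderings :: "monom \<Rightarrow> nat list set" where
  "orderings a = {K. exps K = a}"

text \<open>Orderings are the permutations of one multiset, so a multinomial coefficient counts
  them; it is written here without division.\<close>

lemma card_orderings:
  "card (orderings a) * (\<Prod>i\<in>Poly_Mapping.keys a. fact (Poly_Mapping.lookup a i)) = fact (mdeg a)"
proof -
  obtain K where K: "exps K = a" using ex_exps by blast
  have "orderings a = permutations_of_multiset (mset K)"
    by (auto simp: orderings_def permutations_of_multiset_def exps_eq_iff simp flip: K)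
  then show ?thesis
    using card_permutations_of_multiset_aux[of "mset K"]
    by (simp add: keys_exps lookup_exps mdeg_exps flip: K)
qed

lemma card_orderings_pos: "0 < card (orderings a)"
  using card_orderings[of a] by (metis fact_nonzero mult_is_0 neq0_conv)

lemma orderings_tuples:
  assumes "Poly_Mapping.keys a \<subseteq> {..<n}"
  shows "orderings a = {K \<in> tuples n (mdeg a). exps K = a}"
  using assms by (auto simp: orderings_def tuples_def keys_exps mdeg_exps)

text \<open>The fibre of \<open>exps\<close> over a vector in the image is the full set of its
  orderings, so the weight cancels the multiplicity.\<close>

lemma sum_tuples_exps:
  fixes g :: "monom \<Rightarrow> real"
  shows "(\<Sum>K\<in>tuples n k. g (exps K) / card (orderings (exps K))) = (\<Sum>a\<in>exps ` tuples n k. g a)"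
proof -
  have "(\<Sum>K\<in>tuples n k. g (exps K) / card (orderings (exps K))) =
      (\<Sum>a\<in>exps ` tuples n k. \<Sum>K\<in>{K\<in>tuples n k. exps K = a}. g (exps K) / card (orderings (exps K)))"
    by (simp add: sum.image_gen[where g = exps])
  also have "\<dots> = (\<Sum>a\<in>exps ` tuples n k. g a)"
  proof (rule sum.cong[OF refl])
    fix a assume "a \<in> exps ` tuples n k"
    then have "{K\<in>tuples n k. exps K = a} = orderings a"
      by (subst orderings_tuples[of _ n]) (auto simp: tuples_def keys_exps mdeg_exps)
    moreover have "(\<Sum>K\<in>orderings a. g (exps K) / card (orderings (exps K))) =
        (\<Sum>K\<in>orderings a. g a / card (orderings a))"
      by (intro sum.cong) (auto simp: orderings_def)
    ultimately show "(\<Sum>K\<in>{K\<in>tuples n k. exps K = a}. g (exps K) / card (orderings (exps K))) = g a"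
      using card_orderings_pos[of a] by simp
  qed
  finally show ?thesis .
qed

section \<open>Matrix representations and the sphere norm\<close>

text \<open>One splitting serves two purposes: cutting a word into row and column index, and cutting
  a row index into a position inside a block and a block label.\<close>

lemma tuples_append:
  "bij_betw (\<lambda>(I, J). I @ J) (tuples n k \<times> tuples n l) (tuples n (k + l))"
proof (rule bij_betw_byWitness[where f' = "\<lambda>K. (take k K, drop k K)"])
  show "(\<lambda>K. (take k K, drop k K)) ` tuples n (k + l) \<subseteq> tuples n k \<times> tuples n l"
    by (fastforce simp: tuples_def dest: in_set_takeD in_set_dropD)
qed (auto simp: tuples_def)

lemma sum_tuples_append:
  "(\<Sum>K\<in>tuples n (k + l). g K) = (\<Sum>I\<in>tuples n k. \<Sum>J\<in>tuples n l. g (I @ J))"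
  for g :: "nat list \<Rightarrow> real"
  using sum.reindex_bij_betw[OF tuples_append, of g n k l]
  by (simp add: sum.cartesian_product case_prod_beta)

lemma tensor_power_append: "tensor_power x (I @ J) = tensor_power x I * tensor_power x J"
  by (simp add: tensor_power_def)

text \<open>The sum factors over the positions of the word. Consequently tensor powers of unit
  vectors are admissible in the supremum of a quadratic form.\<close>

lemma sum_tensor_power_sq: "(\<Sum>I\<in>tuples n k. (tensor_power x I)\<^sup>2) = (\<Sum>i<n. (x i)\<^sup>2) ^ k"
proof (induction k)
  case 0
  have "tuples n 0 = {[]}" by (auto simp: tuples_def)
  then show ?case by (simp add: tensor_power_def)
next
  case (Suc k)
  have 1: "tuples n 1 = (\<lambda>i. [i]) ` {..<n}"
    by (auto simp: tuples_def length_Suc_conv)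
  have "(\<Sum>I\<in>tuples n (1 + k). (tensor_power x I)\<^sup>2) =
      (\<Sum>I\<in>tuples n 1. (tensor_power x I)\<^sup>2) * (\<Sum>I\<in>tuples n k. (tensor_power x I)\<^sup>2)"
    by (simp only: sum_tuples_append tensor_power_append power_mult_distrib sum_product)
  also have "(\<Sum>I\<in>tuples n 1. (tensor_power x I)\<^sup>2) = (\<Sum>i<n. (x i)\<^sup>2)"
    unfolding 1 by (subst sum.reindex) (auto simp: tensor_power_def inj_on_def)
  finally show ?case by (simp add: Suc)
qed

lemma L2_set_tensor_power:
  "L2_set x {..<n} = 1 \<Longrightarrow> L2_set (tensor_power x) (tuples n k) = 1"
  by (simp add: L2_set_def sum_tensor_power_sq real_sqrt_eq_1_iff)

lemma ex_unit_vector: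
  fixes n :: nat
  assumes "0 < n"
  shows "\<exists>x. L2_set x {..<n} = 1 \<and> (\<forall>i. 0 \<le> x i)"
proof -
  let ?x = "\<lambda>i::nat. if i = 0 then 1 else 0 :: real"
  have "(\<Sum>i<n. (?x i)\<^sup>2) = (\<Sum>i\<in>{0}. (?x i)\<^sup>2)"
    using assms by (intro sum.mono_neutral_right) auto
  then show ?thesis by (intro exI[of _ ?x]) (simp add: L2_set_def)
qed

section \<open>Quadratic forms on the unit sphere\<close>

lemma abs_le_L2_set: "finite A \<Longrightarrow> i \<in> A \<Longrightarrow> \<bar>z i\<bar> \<le> L2_set z A"
  using member_le_L2_set[of A i "\<lambda>i. \<bar>z i\<bar>"] by (simp add: L2_set_def)

lemma bdd_above_quad_form:
  assumes "finite A"
  shows "bdd_above (quad_form A M ` {z. L2_set z A = 1})"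
proof (rule bdd_aboveI2)
  fix z assume "z \<in> {z. L2_set z A = 1}"
  then have z: "\<bar>z I\<bar> \<le> 1" if "I \<in> A" for I
    using abs_le_L2_set[OF assms that, of z] by simp
  have "z I * M I J * z J \<le> \<bar>M I J\<bar>" if "I \<in> A" "J \<in> A" for I J
  proof -
    have "\<bar>z I * M I J * z J\<bar> \<le> 1 * \<bar>M I J\<bar> * 1"
      unfolding abs_mult using z[OF that(1)] z[OF that(2)]
      by (intro mult_mono) auto
    then show ?thesis by simp
  qed
  then show "quad_form A M z \<le> (\<Sum>I\<in>A. \<Sum>J\<in>A. \<bar>M I J\<bar>)"
    unfolding quad_form_def by (intro sum_mono)
qed

lemma quad_form_scale: "quad_form A M (\<lambda>I. c * z I) = c\<^sup>2 * quad_form A M z"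
  by (simp add: quad_form_def sum_distrib_left power2_eq_square mult_ac)

text \<open>Homogeneity of degree 2 carries the bound from unit vectors to all vectors, such as
  slices of a unit vector. The zero vector cannot be normalised and is treated apart.\<close>

lemma quad_form_le_SUP:
  assumes "finite A"
  shows "quad_form A M z \<le> (SUP z\<in>{z. L2_set z A = 1}. quad_form A M z) * (\<Sum>I\<in>A. (z I)\<^sup>2)"
proof (cases "L2_set z A = 0")
  case True
  then have "z I = 0" if "I \<in> A" for I
    using L2_set_eq_0_iff[OF assms] that by blast
  then show ?thesis by (simp add: quad_form_def)
next
  case False
  let ?r = "L2_set z A"
  have r: "0 < ?r" using False by (simp add: less_le)
  have "L2_set (\<lambda>I. inverse ?r * z I) A = inverse ?r * ?r"
    using L2_set_right_distrib[of "inverse ?r" z A] r by simp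
  then have "quad_form A M (\<lambda>I. inverse ?r * z I) \<le> (SUP z\<in>{z. L2_set z A = 1}. quad_form A M z)"
    using r by (intro cSUP_upper bdd_above_quad_form assms) simp
  then have "quad_form A M z \<le> (SUP z\<in>{z. L2_set z A = 1}. quad_form A M z) * ?r\<^sup>2"
    using r unfolding quad_form_scale by (simp add: power_inverse field_simps)
  then show ?thesis by (simp add: L2_set_def sum_nonneg)
qed

section \<open>Existence of representations and basic properties of Lambda\<close>

lemma eval_poly_tuples:
  assumes "homogeneous n t h"
  shows "eval_poly x h =
    (\<Sum>K\<in>tuples n t. Poly_Mapping.lookup h (exps K) / card (orderings (exps K)) * tensor_power x K)"
proof -
  have sub: "Poly_Mapping.keys h \<subseteq> exps ` tuples n t"
  proof
    fix m assume m: "m \<in> Poly_Mapping.keys h"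
    obtain K where "exps K = m" using ex_exps by blast
    with m assms show "m \<in> exps ` tuples n t"
      by (force simp: homogeneous_def tuples_def keys_exps mdeg_exps)
  qed
  have "eval_poly x h = (\<Sum>m\<in>exps ` tuples n t. Poly_Mapping.lookup h m * mono_val x m)"
    by (rule eval_poly_superset[OF _ sub]) simp
  then show ?thesis
    by (simp add: sum_tuples_exps[symmetric] mono_val_exps)
qed

lemma ex_matrix_rep:
  assumes "homogeneous n t h" "even t"
  shows "\<exists>M. matrix_rep n t h M"
proof -
  \<comment> \<open>The coefficient of a monomial is shared equally among all its orderings. An
    entry depends only on the multiset of \<open>I @ J\<close>, which gives symmetry.\<close>
  let ?M = "\<lambda>I J. Poly_Mapping.lookup h (exps (I @ J)) / card (orderings (exps (I @ J)))"
  have t: "t div 2 + t div 2 = t" using assms(2) by auto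
  have "quad_form (tuples n (t div 2)) ?M (tensor_power x) = eval_poly x h" for x
    using sum_tuples_append[of "\<lambda>K. Poly_Mapping.lookup h (exps K) / card (orderings (exps K)) *
      tensor_power x K" n "t div 2" "t div 2"]
    unfolding t eval_poly_tuples[OF assms(1)]
    by (simp add: quad_form_def tensor_power_append mult_ac)
  moreover have "?M I J = ?M J I" for I J
    by (simp add: exps_append add.commute)
  ultimately show ?thesis
    unfolding matrix_rep_def by (intro exI[of _ ?M]) blast
qed

text \<open>The tensor power of \<open>x\<close> is a unit vector at which the form takes the value
  of \<open>h\<close>. This bounds the suprema below uniformly in \<open>M\<close>, so the infimum
  in \<open>Lam\<close> is a genuine one.\<close>

lemma eval_poly_le_SUP:
  assumes "matrix_rep n t h M" "L2_set x {..<n} = 1"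
  shows "eval_poly x h \<le>
    (SUP z\<in>{z. L2_set z (tuples n (t div 2)) = 1}. quad_form (tuples n (t div 2)) M z)"
proof -
  have "quad_form (tuples n (t div 2)) M (tensor_power x) \<le>
    (SUP z\<in>{z. L2_set z (tuples n (t div 2)) = 1}. quad_form (tuples n (t div 2)) M z)"
    using assms(2) by (intro cSUP_upper bdd_above_quad_form) (simp_all add: L2_set_tensor_power)
  then show ?thesis using assms(1) by (simp add: matrix_rep_def)
qed

lemma Lam_le:
  assumes "0 < n" "matrix_rep n t h M"
  shows "Lam n t h \<le>
    (SUP z\<in>{z. L2_set z (tuples n (t div 2)) = 1}. quad_form (tuples n (t div 2)) M z)"
proof -
  obtain x where x: "L2_set x {..<n} = 1" using ex_unit_vector[OF assms(1)] by blast
  show ?thesis unfolding Lam_def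
    by (rule cINF_lower)
       (use assms(2) in \<open>auto intro!: bdd_belowI2[where m = "eval_poly x h"] eval_poly_le_SUP[OF _ x]\<close>)
qed

lemma Lam_ge:
  assumes "homogeneous n t h" "even t" "L2_set x {..<n} = 1"
  shows "eval_poly x h \<le> Lam n t h"
  unfolding Lam_def using ex_matrix_rep[OF assms(1,2)]
  by (intro cINF_greatest) (auto intro: eval_poly_le_SUP[OF _ assms(3)])

lemma Lam_nonneg:
  assumes "0 < n" "homogeneous n t h" "even t" "nonneg_coeffs h"
  shows "0 \<le> Lam n t h"
proof -
  obtain x where x: "L2_set x {..<n} = 1" "\<And>i. 0 \<le> x i" using ex_unit_vector[OF assms(1)] by blast
  have "0 \<le> eval_poly x h" by (rule eval_poly_nonneg) (use assms x in auto)
  also have "\<dots> \<le> Lam n t h" using assms x by (intro Lam_ge) auto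
  finally show ?thesis .
qed

lemma Lam_zero:
  assumes "0 < n" "even t"
  shows "Lam n t 0 = 0"
proof (rule antisym)
  obtain x where x: "L2_set x {..<n} = 1" using ex_unit_vector[OF assms(1)] by blast
  have ne: "\<exists>z. L2_set z (tuples n (t div 2)) = 1"
    using L2_set_tensor_power[OF x] by blast
  have "matrix_rep n t 0 (\<lambda>_ _. 0)"
    by (simp add: matrix_rep_def quad_form_def)
  from Lam_le[OF assms(1) this] show "Lam n t 0 \<le> 0"
    using ne by (simp add: quad_form_def)
  show "0 \<le> Lam n t 0"
    using assms by (intro Lam_nonneg) (auto simp: homogeneous_def nonneg_coeffs_def)
qed

text \<open>An arbitrarily small slack \<open>e\<close> replaces attainment of the infimum; it
  disappears in a limit later.\<close>

lemma ex_near_optimal_matrix_rep: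
  assumes "homogeneous n t h" "even t" "0 < e"
  shows "\<exists>M. matrix_rep n t h M \<and> (\<forall>z. quad_form (tuples n (t div 2)) M z \<le>
    (Lam n t h + e) * (\<Sum>I\<in>tuples n (t div 2). (z I)\<^sup>2))"
proof -
  let ?s = "\<lambda>M. SUP z\<in>{z. L2_set z (tuples n (t div 2)) = 1}. quad_form (tuples n (t div 2)) M z"
  have "\<exists>M\<in>{M. matrix_rep n t h M}. ?s M < Lam n t h + e"
  proof (rule ccontr)
    assume "\<not> ?thesis"
    then have "Lam n t h + e \<le> (INF M\<in>{M. matrix_rep n t h M}. ?s M)"
      using ex_matrix_rep[OF assms(1,2)] by (intro cINF_greatest) force+
    then show False using assms(3) by (simp add: Lam_def)
  qed
  then obtain M where M: "matrix_rep n t h M" "?s M < Lam n t h + e" by blast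
  have "quad_form (tuples n (t div 2)) M z \<le> (Lam n t h + e) * (\<Sum>I\<in>tuples n (t div 2). (z I)\<^sup>2)" for z
    by (rule order.trans[OF quad_form_le_SUP])
       (use M(2) in \<open>auto intro!: mult_right_mono sum_nonneg\<close>)
  with M(1) show ?thesis by blast
qed

section \<open>The sphere norm\<close>

lemma bdd_above_sphere:
  assumes "homogeneous n t h"
  shows "bdd_above ((\<lambda>x. \<bar>eval_poly x h\<bar>) ` {x. L2_set x {..<n} = 1})"
proof (rule bdd_aboveI2)
  fix x assume "x \<in> {x. L2_set x {..<n} = 1}"
  then have x: "\<bar>x i\<bar> \<le> 1" if "i < n" for i
    using abs_le_L2_set[of "{..<n}" i x] that by simp
  have "\<bar>mono_val x m\<bar> \<le> 1" if "m \<in> Poly_Mapping.keys h" for m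
    using assms that x unfolding mono_val_def abs_prod power_abs
    by (intro prod_le_1) (auto simp: homogeneous_def intro!: power_le_one)
  then show "\<bar>eval_poly x h\<bar> \<le> (\<Sum>m\<in>Poly_Mapping.keys h. \<bar>Poly_Mapping.lookup h m\<bar>)"
    unfolding eval_poly_mono_val
    by (intro order.trans[OF sum_abs] sum_mono) (simp add: abs_mult mult_left_le)
qed

lemma abs_eval_poly_le_sphere_norm:
  assumes "homogeneous n t h" "L2_set x {..<n} = 1"
  shows "\<bar>eval_poly x h\<bar> \<le> sphere_norm n h"
  unfolding sphere_norm_def using assms by (intro cSUP_upper bdd_above_sphere) auto

lemma sphere_norm_nonneg:
  assumes "0 < n" "homogeneous n t h"
  shows "0 \<le> sphere_norm n h"
  using abs_eval_poly_le_sphere_norm[OF assms(2)] ex_unit_vector[OF assms(1)]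
  by (meson abs_ge_zero order.trans)

lemma eval_poly_le_sphere_norm:
  assumes h: "homogeneous n t h" and x: "0 < L2_set x {..<n}"
  shows "eval_poly x h \<le> L2_set x {..<n} ^ t * sphere_norm n h"
proof -
  let ?r = "L2_set x {..<n}"
  have "L2_set (\<lambda>i. inverse ?r * x i) {..<n} = 1"
    using L2_set_right_distrib[of "inverse ?r" x "{..<n}"] x by simp
  from abs_eval_poly_le_sphere_norm[OF h this]
  have "inverse ?r ^ t * eval_poly x h \<le> sphere_norm n h"
    unfolding eval_poly_scale[OF h] by linarith
  then show ?thesis
    using x by (simp add: power_inverse field_simps)
qed

text \<open>Nonnegative coefficients cannot cancel at the all-ones point. This settles the parts
  whose quotient has denominator zero.\<close>

lemma sphere_norm_eq_0:
  assumes "0 < n" "homogeneous n t h" "nonneg_coeffs h" "sphere_norm n h = 0"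
  shows "h = 0"
proof -
  let ?x = "\<lambda>_::nat. 1::real"
  have "0 < L2_set ?x {..<n}" using assms(1) by (simp add: L2_set_def)
  from eval_poly_le_sphere_norm[OF assms(2) this]
  have "(\<Sum>m\<in>Poly_Mapping.keys h. Poly_Mapping.lookup h m) \<le> 0"
    by (simp add: assms(4) eval_poly_mono_val mono_val_def)
  moreover have "0 < (\<Sum>m\<in>Poly_Mapping.keys h. Poly_Mapping.lookup h m)" if "Poly_Mapping.keys h \<noteq> {}"
    using that assms(3) by (intro sum_pos) (auto simp: nonneg_coeffs_def in_keys_iff less_le)
  ultimately show "h = 0" by fastforce
qed

section \<open>The multilinear decomposition\<close>

text \<open>For nonzero \<open>a\<close> of degree k, the point \<open>y\<close> maximises y^(2a) on
  the unit sphere, with value (prod a_i^a_i) / k^k. This is at least a!/k^k, since a_i! \<le>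
  a_i^a_i, and the bound on k^k turns it into the inverse multinomial coefficient up to 4^k.\<close>

lemma mono_val_witness:
  fixes a :: monom
  defines "y \<equiv> \<lambda>i. sqrt (Poly_Mapping.lookup a i / mdeg a)"
  shows "1 \<le> 4 ^ mdeg a * card (orderings a) * mono_val y (a + a)"
proof -
  let ?k = "mdeg a" and ?P = "\<Prod>i\<in>Poly_Mapping.keys a. fact (Poly_Mapping.lookup a i) :: real"
  have "mono_val y (a + a) = (\<Prod>i\<in>Poly_Mapping.keys a. (y i ^ Poly_Mapping.lookup a i)\<^sup>2)"
    unfolding mono_val_add by (simp add: mono_val_def power2_eq_square prod.distrib)
  also have "\<dots> = (\<Prod>i\<in>Poly_Mapping.keys a. real (Poly_Mapping.lookup a i) ^ Poly_Mapping.lookup a i /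
      real ?k ^ Poly_Mapping.lookup a i)"
    by (intro prod.cong refl)
       (simp add: y_def power_mult[symmetric] mult.commute[of _ 2] power_mult power_divide)
  also have "\<dots> = (\<Prod>i\<in>Poly_Mapping.keys a. real (Poly_Mapping.lookup a i) ^ Poly_Mapping.lookup a i) /
      real ?k ^ ?k"
    by (simp add: prod_dividef power_sum[symmetric] mdeg_def)
  finally have y: "mono_val y (a + a) =
    (\<Prod>i\<in>Poly_Mapping.keys a. real (Poly_Mapping.lookup a i) ^ Poly_Mapping.lookup a i) / real ?k ^ ?k" .
  \<comment> \<open>The case of degree 0 rests on 0^0 = 1.\<close>
  have kk: "0 < real ?k ^ ?k" by (cases "?k = 0") auto
  have "?P \<le> (\<Prod>i\<in>Poly_Mapping.keys a. real (Poly_Mapping.lookup a i) ^ Poly_Mapping.lookup a i)"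
    by (intro prod_mono) (auto intro: order.trans[OF fact_le_power])
  then have P: "?P \<le> mono_val y (a + a) * real ?k ^ ?k"
    using kk by (simp add: y)
  \<comment> \<open>a single term of the exponential series of \<open>k\<close> gives \<open>k\<^sup>k \<le> 4\<^sup>k k!\<close>\<close>
  have "real ?k ^ ?k / fact ?k \<le> suminf (\<lambda>j. real ?k ^ j /\<^sub>R fact j)"
    using sum_le_suminf[OF summable_exp_generic[of "real ?k"], of "{?k}"] by (simp add: field_simps)
  also have "\<dots> = exp (real ?k)" by (simp add: exp_def)
  also have "\<dots> = exp 1 ^ ?k" using exp_of_nat_mult[of ?k "1::real"] by simp
  also have "\<dots> \<le> 4 ^ ?k" using exp_le by (intro power_mono) auto
  finally have "real ?k ^ ?k \<le> 4 ^ ?k * fact ?k" by (simp add: field_simps)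
  also have "fact ?k = card (orderings a) * ?P"
    using arg_cong[OF card_orderings[of a], of real] by simp
  also have "4 ^ ?k * (card (orderings a) * ?P) \<le>
      4 ^ ?k * (card (orderings a) * (mono_val y (a + a) * real ?k ^ ?k))"
    using P by (intro mult_left_mono) auto
  finally show ?thesis using kk by (simp add: mult.assoc)
qed

text \<open>Equality holds unless \<open>a\<close> is 0; then division by zero makes the vector
  zero, hence only \<le>.\<close>

lemma L2_set_witness:
  assumes "Poly_Mapping.keys a \<subseteq> {..<n}"
  shows "L2_set (\<lambda>i. sqrt (Poly_Mapping.lookup a i / mdeg a)) {..<n} \<le> 1"
  using mdeg_superset[of "{..<n}" a] assms
  by (simp add: L2_set_def sum_divide_distrib[symmetric] flip: of_nat_sum)

text \<open>\<open>m\<close> and \<open>a\<close> are recovered from \<open>m + 2a\<close> as remainder and quotient modulo 2.\<close>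

lemma multilinear_part_unique:
  fixes m m' a b :: monom
  assumes "\<And>i. Poly_Mapping.lookup m i \<le> 1" "\<And>i. Poly_Mapping.lookup m' i \<le> 1"
    "m' + (b + b) = m + (a + a)"
  shows "m' = m \<and> b = a"
proof -
  have "Poly_Mapping.lookup m' i = Poly_Mapping.lookup m i \<and>
    Poly_Mapping.lookup b i = Poly_Mapping.lookup a i" for i
    using assms(1,2)[of i] arg_cong[OF assms(3), of "\<lambda>p. Poly_Mapping.lookup p i"]
    unfolding lookup_add by presburger
  then show ?thesis by (auto intro!: poly_mapping_eqI)
qed

text \<open>Distinct pairs (m, a) with m multilinear give distinct exponents m + 2a, so nothing
  collides in the sum and exactly one term contributes. Through this, nonnegativity passes from
  \<open>f\<close> to its parts.\<close>

lemma lookup_decomposition: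
  assumes dec: "multilinear_decomposition n d f F"
    and a: "a \<in> exponents n (d div 2)" and m: "m \<in> Poly_Mapping.keys (F a)"
  shows "Poly_Mapping.lookup f (m + (a + a)) = Poly_Mapping.lookup (F a) m"
proof -
  have ml: "Poly_Mapping.lookup m' i \<le> 1"
    if "b \<in> exponents n (d div 2)" "m' \<in> Poly_Mapping.keys (F b)" for b m' i
    using dec that by (auto simp: multilinear_decomposition_def multilinear_def)
  have f: "f = (\<Sum>b\<in>exponents n (d div 2). F b * Poly_Mapping.single (b + b) 1)"
    using dec by (simp add: multilinear_decomposition_def)
  have "Poly_Mapping.lookup f (m + (a + a)) = (\<Sum>b\<in>exponents n (d div 2).
      \<Sum>m'\<in>Poly_Mapping.keys (F b). Poly_Mapping.lookup (F b) m' when m' + (b + b) = m + (a + a))"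
    by (subst f) (simp add: lookup_sum lookup_times_monomial)
  also have "\<dots> = (\<Sum>b\<in>exponents n (d div 2). if b = a then Poly_Mapping.lookup (F a) m else 0)"
  proof (rule sum.cong[OF refl])
    fix b assume b: "b \<in> exponents n (d div 2)"
    have eq: "m' + (b + b) = m + (a + a) \<longleftrightarrow> m' = m \<and> b = a"
      if "m' \<in> Poly_Mapping.keys (F b)" for m'
      using multilinear_part_unique[OF ml[OF a m] ml[OF b that]] by blast
    have "(\<Sum>m'\<in>Poly_Mapping.keys (F b). Poly_Mapping.lookup (F b) m' when m' + (b + b) = m + (a + a)) =
        (\<Sum>m'\<in>Poly_Mapping.keys (F b). if m' = m then (if b = a then Poly_Mapping.lookup (F b) m else 0) else 0)"
      by (intro sum.cong refl) (auto simp: eq when_def)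
    then show "(\<Sum>m'\<in>Poly_Mapping.keys (F b). Poly_Mapping.lookup (F b) m' when m' + (b + b) = m + (a + a)) =
        (if b = a then Poly_Mapping.lookup (F a) m else 0)"
      using m by simp
  qed
  finally show ?thesis using a by simp
qed

lemma nonneg_coeffs_decomposition:
  assumes "multilinear_decomposition n d f F" "nonneg_coeffs f" "a \<in> exponents n (d div 2)"
  shows "nonneg_coeffs (F a)"
  unfolding nonneg_coeffs_def
proof
  fix m
  show "0 \<le> Poly_Mapping.lookup (F a) m"
    using lookup_decomposition[OF assms(1,3), of m] assms(2)
    by (cases "m \<in> Poly_Mapping.keys (F a)") (metis nonneg_coeffs_def, simp add: in_keys_iff)
qed

lemma eval_poly_decomposition:
  assumes "multilinear_decomposition n d f F"
  shows "eval_poly x f = (\<Sum>a\<in>exponents n (d div 2). eval_poly x (F a) * mono_val x (a + a))"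
proof -
  have f: "f = (\<Sum>b\<in>exponents n (d div 2). F b * Poly_Mapping.single (b + b) 1)"
    using assms by (simp add: multilinear_decomposition_def)
  show ?thesis
    by (subst f) (simp add: eval_poly_sum eval_poly_times_monomial)
qed

section \<open>Comparison of the norms of the parts with the norm of f\<close>

lemma sphere_norm_part_le:
  assumes n: "0 < n" and f: "homogeneous n d f" "nonneg_coeffs f"
    and dec: "multilinear_decomposition n d f F" and a: "a \<in> exponents n (d div 2)"
  shows "sphere_norm n (F a) \<le> 4 ^ d * real (card (orderings a)) * sphere_norm n f"
  unfolding sphere_norm_def[of n "F a"]
proof (rule cSUP_least)
  show "{x. L2_set x {..<n} = 1} \<noteq> {}" using ex_unit_vector[OF n] by blast
next
  fix x :: "nat \<Rightarrow> real" assume "x \<in> {x. L2_set x {..<n} = 1}"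
  define y where "y = (\<lambda>i. sqrt (Poly_Mapping.lookup a i / mdeg a))"
  \<comment> \<open>Both |x| and \<open>y\<close> lie below \<open>w\<close> coordinatewise, so by
    monotonicity one point serves the factor \<open>F a\<close> and the monomial at once.\<close>
  define w where "w = (\<lambda>i. \<bar>x i\<bar> + y i)"
  have x: "L2_set (\<lambda>i. \<bar>x i\<bar>) {..<n} = 1"
    using \<open>x \<in> _\<close> by (simp add: L2_set_def)
  have y0: "0 \<le> y i" for i by (simp add: y_def)
  have w0: "0 \<le> w i" "\<bar>x i\<bar> \<le> w i" "y i \<le> w i" for i using y0[of i] by (simp_all add: w_def)
  \<comment> \<open>The lower bound makes it possible to normalise \<open>w\<close>; the upper bound
    costs the first factor 2^d.\<close>
  have w1: "1 \<le> L2_set w {..<n}"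
    using L2_set_mono[of "{..<n}" "\<lambda>i. \<bar>x i\<bar>" w] w0 x by simp
  have "L2_set y {..<n} \<le> 1"
    unfolding y_def using a by (intro L2_set_witness) (simp add: exponents_def)
  then have w2: "L2_set w {..<n} \<le> 2"
    using L2_set_triangle_ineq[of "\<lambda>i. \<bar>x i\<bar>" y "{..<n}"] x by (simp add: w_def)
  have nnF: "nonneg_coeffs (F b)" if "b \<in> exponents n (d div 2)" for b
    using nonneg_coeffs_decomposition[OF dec f(2) that] .
  let ?e = "eval_poly (\<lambda>i. \<bar>x i\<bar>) (F a)" and ?y = "mono_val y (a + a)" and ?N = "sphere_norm n f"
  let ?c = "real (card (orderings a))"
  have e0: "0 \<le> ?e" by (rule eval_poly_nonneg[OF nnF[OF a]]) simp
  have "?e * ?y \<le> eval_poly w (F a) * mono_val w (a + a)"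
    using w0 y0 nnF[OF a] by (intro mult_mono eval_poly_mono mono_val_mono eval_poly_nonneg mono_val_nonneg) auto
  \<comment> \<open>All summands of the decomposition are nonnegative at \<open>w\<close>, so a
    single one is bounded by the whole.\<close>
  also have "\<dots> \<le> eval_poly w f"
    unfolding eval_poly_decomposition[OF dec] using a w0 nnF
    by (intro member_le_sum[where f = "\<lambda>a. eval_poly w (F a) * mono_val w (a + a)"])
       (auto intro!: mult_nonneg_nonneg eval_poly_nonneg mono_val_nonneg)
  also have "\<dots> \<le> L2_set w {..<n} ^ d * ?N"
    using w1 by (intro eval_poly_le_sphere_norm[OF f(1)]) auto
  also have "\<dots> \<le> 2 ^ d * ?N"
    using w1 w2 sphere_norm_nonneg[OF n f(1)] by (intro mult_right_mono power_mono) auto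
  finally have ey: "?e * ?y \<le> 2 ^ d * ?N" .
  \<comment> \<open>The second factor 2^d arises because twice the degree of \<open>a\<close> is at
    most d.\<close>
  have "4 ^ mdeg a = (2::real) ^ (2 * mdeg a)" by (simp add: power_mult)
  also have "\<dots> \<le> 2 ^ d" using a by (intro power_increasing) (auto simp: exponents_def)
  finally have k: "(4::real) ^ mdeg a \<le> 2 ^ d" .
  have "\<bar>eval_poly x (F a)\<bar> \<le> ?e * 1" using abs_eval_poly_le[OF nnF[OF a], of x] by simp
  also have "\<dots> \<le> ?e * (4 ^ mdeg a * ?c * ?y)"
    using e0 mono_val_witness[of a] by (intro mult_left_mono) (simp_all add: y_def)
  also have "\<dots> = 4 ^ mdeg a * ?c * (?e * ?y)" by simp
  also have "\<dots> \<le> 2 ^ d * ?c * (2 ^ d * ?N)"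
    using k ey e0 y0
    by (intro mult_mono[of "4 ^ mdeg a * ?c" "2 ^ d * ?c"] mult_right_mono)
       (auto intro: mult_nonneg_nonneg mono_val_nonneg)
  also have "\<dots> = 4 ^ d * ?c * ?N" by (simp add: power_mult_distrib[symmetric])
  finally show "\<bar>eval_poly x (F a)\<bar> \<le> 4 ^ d * ?c * ?N" .
qed

section \<open>Block diagonal representations and the upper bound on Lambda\<close>

lemma quad_form_sum: "quad_form A (\<lambda>I J. \<Sum>k\<in>S. M k I J) z = (\<Sum>k\<in>S. quad_form A (M k) z)"
proof -
  have "quad_form A (\<lambda>I J. \<Sum>k\<in>S. M k I J) z = (\<Sum>I\<in>A. \<Sum>J\<in>A. \<Sum>k\<in>S. z I * M k I J * z J)"
    by (simp add: quad_form_def sum_distrib_left sum_distrib_right)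
  also have "\<dots> = (\<Sum>k\<in>S. quad_form A (M k) z)"
    unfolding quad_form_def by (subst (2) sum.swap, subst sum.swap) (rule refl)
  finally show ?thesis .
qed

definition block_diag ::
  "nat \<Rightarrow> (nat list \<Rightarrow> nat list \<Rightarrow> nat list \<Rightarrow> real) \<Rightarrow> nat list \<Rightarrow> nat list \<Rightarrow> real" where
  "block_diag l B I J = (if drop l I = drop l J then B (drop l I) (take l I) (take l J) else 0)"

text \<open>Only rows and columns with the same tail interact, so each block sees one slice
  \<open>z (I @ K)\<close> and the forms add up.\<close>

lemma quad_form_block_diag:
  "quad_form (tuples n (l + k)) (block_diag l B) z =
     (\<Sum>K\<in>tuples n k. quad_form (tuples n l) (B K) (\<lambda>I. z (I @ K)))"
proof -
  have "quad_form (tuples n (l + k)) (block_diag l B) z =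
      (\<Sum>I\<in>tuples n l. \<Sum>K\<in>tuples n k. \<Sum>J\<in>tuples n l. \<Sum>L\<in>tuples n k.
        z (I @ K) * block_diag l B (I @ K) (J @ L) * z (J @ L))"
    by (simp add: quad_form_def sum_tuples_append)
  also have "\<dots> = (\<Sum>I\<in>tuples n l. \<Sum>K\<in>tuples n k. \<Sum>J\<in>tuples n l. \<Sum>L\<in>tuples n k.
        if K = L then z (I @ K) * B K I J * z (J @ K) else 0)"
    by (intro sum.cong refl) (auto simp: block_diag_def tuples_def)
  also have "\<dots> = (\<Sum>I\<in>tuples n l. \<Sum>K\<in>tuples n k. \<Sum>J\<in>tuples n l. z (I @ K) * B K I J * z (J @ K))"
    by simp
  also have "\<dots> = (\<Sum>K\<in>tuples n k. quad_form (tuples n l) (B K) (\<lambda>I. z (I @ K)))"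
    by (subst sum.swap) (simp add: quad_form_def)
  finally show ?thesis .
qed

lemma quad_form_divide: "quad_form A (\<lambda>I J. M I J / c) z = quad_form A M z / c"
  by (simp add: quad_form_def sum_divide_distrib)

text \<open>The layers are disjoint because \<open>mdeg\<close> recovers the tuple length.\<close>

lemma exponents_disjoint_sum:
  fixes g :: "monom \<Rightarrow> real"
  shows "(\<Sum>a\<in>exponents n l. g a) = (\<Sum>k\<le>l. \<Sum>a\<in>exps ` tuples n k. g a)"
  unfolding exponents_eq
  by (rule sum.UNION_disjoint)
     (simp_all, auto simp: tuples_def dest!: arg_cong[where f = mdeg] simp: mdeg_exps)

lemma Lam_decomposition_le:
  fixes c :: real
  assumes n: "0 < n" and d: "even d" and dec: "multilinear_decomposition n d f F"
    and c: "\<And>a. a \<in> exponents n (d div 2) \<Longrightarrow> Lam n (d - 2 * mdeg a) (F a) \<le> c * card (orderings a)"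
  shows "Lam n d f \<le> real (d div 2 + 1) * c"
proof (rule field_le_epsilon)
  fix e :: real assume e: "0 < e"
  define D where "D = d div 2"
  \<comment> \<open>The slack is shared equally among the D + 1 layers.\<close>
  define e' where "e' = e / (D + 1)"
  have e': "0 < e'" using e by (simp add: e'_def)
  have dk: "(d - 2 * k) div 2 = D - k" for k by (simp add: D_def)
  have "\<exists>M. matrix_rep n (d - 2 * mdeg a) (F a) M \<and> (\<forall>z. quad_form (tuples n (D - mdeg a)) M z \<le>
      (Lam n (d - 2 * mdeg a) (F a) + e') * (\<Sum>I\<in>tuples n (D - mdeg a). (z I)\<^sup>2))"
    if "a \<in> exponents n D" for a
    using ex_near_optimal_matrix_rep[of n "d - 2 * mdeg a" "F a" e'] dec that d e'
    by (auto simp: multilinear_decomposition_def D_def dk)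
  then obtain B where
    B: "\<And>a. a \<in> exponents n D \<Longrightarrow> matrix_rep n (d - 2 * mdeg a) (F a) (B a)"
      "\<And>a z. a \<in> exponents n D \<Longrightarrow> quad_form (tuples n (D - mdeg a)) (B a) z \<le>
      (Lam n (d - 2 * mdeg a) (F a) + e') * (\<Sum>I\<in>tuples n (D - mdeg a). (z I)\<^sup>2)"
    by metis
  define N where "N K = real (card (orderings (exps K)))" for K
  have N: "1 \<le> N K" for K using card_orderings_pos[of "exps K"] by (simp add: N_def)
  \<comment> \<open>Layer \<open>k\<close> takes the last \<open>k\<close> positions as block label.
    Different layers overlap in the same entries, hence the sum over \<open>k\<close>.\<close>
  define M where "M I J = (\<Sum>k\<le>D. block_diag (D - k) (\<lambda>K I J. B (exps K) I J / N K) I J)" for I J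
  have K: "exps K \<in> exponents n D" "mdeg (exps K) = k" if "k \<le> D" "K \<in> tuples n k" for k K
    using that exps_in_exponents by (auto simp: mdeg_exps tuples_def)
  have quad: "quad_form (tuples n D) M z =
      (\<Sum>k\<le>D. \<Sum>K\<in>tuples n k. quad_form (tuples n (D - k)) (B (exps K)) (\<lambda>I. z (I @ K)) / N K)" for z
  proof -
    have "quad_form (tuples n D) (block_diag (D - k) (\<lambda>K I J. B (exps K) I J / N K)) z =
        (\<Sum>K\<in>tuples n k. quad_form (tuples n (D - k)) (B (exps K)) (\<lambda>I. z (I @ K)) / N K)" if "k \<le> D" for k
      using quad_form_block_diag[of n "D - k" k "\<lambda>K I J. B (exps K) I J / N K" z] that
      by (simp add: quad_form_divide)
    then show ?thesis unfolding M_def quad_form_sum by simp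
  qed
  have "quad_form (tuples n D) M (tensor_power x) = eval_poly x f" for x
  proof -
    \<comment> \<open>The tail \<open>K\<close> occurs in both the row and the column index, so it
      contributes the square of its monomial.\<close>
    have *: "quad_form (tuples n (D - k)) (B (exps K)) (\<lambda>I. tensor_power x (I @ K)) =
        eval_poly x (F (exps K)) * mono_val x (exps K + exps K)" if "k \<le> D" "K \<in> tuples n k" for k K
    proof -
      have "quad_form (tuples n (D - k)) (B (exps K)) (tensor_power x) = eval_poly x (F (exps K))"
        using B(1)[OF K(1)[OF that]] K(2)[OF that] by (simp add: matrix_rep_def dk)
      then show ?thesis
        using quad_form_scale[of "tuples n (D - k)" "B (exps K)" "tensor_power x K" "tensor_power x"]
        by (simp add: tensor_power_append mono_val_add mono_val_exps power2_eq_square mult_ac)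
    qed
    have "quad_form (tuples n D) M (tensor_power x) =
        (\<Sum>k\<le>D. \<Sum>K\<in>tuples n k. eval_poly x (F (exps K)) * mono_val x (exps K + exps K) / N K)"
      unfolding quad by (simp add: *)
    \<comment> \<open>Each exponent vector is met once per ordering, which the division by
      \<open>N K\<close> undoes.\<close>
    also have "\<dots> = (\<Sum>k\<le>D. \<Sum>a\<in>exps ` tuples n k. eval_poly x (F a) * mono_val x (a + a))"
      unfolding N_def
      using sum_tuples_exps[of "\<lambda>a. eval_poly x (F a) * mono_val x (a + a)"] by simp
    also have "\<dots> = eval_poly x f"
      by (simp add: exponents_disjoint_sum[symmetric] eval_poly_decomposition[OF dec] D_def)
    finally show ?thesis .
  qed
  moreover have "M I J = M J I" if "I \<in> tuples n D" "J \<in> tuples n D" for I J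
    unfolding M_def
  proof (rule sum.cong[OF refl])
    fix k assume "k \<in> {..D}"
    then have k: "k \<le> D" by simp
    have "drop (D - k) I \<in> tuples n k" "take (D - k) I \<in> tuples n (D - k)"
        "take (D - k) J \<in> tuples n (D - k)"
      using that k by (auto simp: tuples_def dest: in_set_takeD in_set_dropD)
    with B(1)[OF K(1)[OF k]] K(2)[OF k]
    show "block_diag (D - k) (\<lambda>K I J. B (exps K) I J / N K) I J =
        block_diag (D - k) (\<lambda>K I J. B (exps K) I J / N K) J I"
      by (auto simp: block_diag_def matrix_rep_def dk)
  qed
  ultimately have rep: "matrix_rep n d f M" by (simp add: matrix_rep_def D_def)
  have "quad_form (tuples n D) M z \<le> real (D + 1) * (c + e')" if z: "L2_set z (tuples n D) = 1" for z
  proof -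
    have "(\<Sum>K\<in>tuples n k. quad_form (tuples n (D - k)) (B (exps K)) (\<lambda>I. z (I @ K)) / N K) \<le> c + e'"
      if k: "k \<le> D" for k
    proof -
      have "quad_form (tuples n (D - k)) (B (exps K)) (\<lambda>I. z (I @ K)) / N K \<le>
          (c + e') * (\<Sum>I\<in>tuples n (D - k). (z (I @ K))\<^sup>2)" if "K \<in> tuples n k" for K
      proof -
        let ?S = "\<Sum>I\<in>tuples n (D - k). (z (I @ K))\<^sup>2"
        \<comment> \<open>As \<open>N K\<close> is at least 1, the slack may be enlarged to a
          multiple of it; dividing by \<open>N K\<close> then leaves \<open>c + e'\<close>.\<close>
        have "Lam n (d - 2 * mdeg (exps K)) (F (exps K)) + e' \<le> c * N K + e' * N K"
          using c[of "exps K"] K(1)[OF k that] e' mult_left_mono[OF N[of K], of e']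
          unfolding N_def D_def by linarith
        then have "(Lam n (d - 2 * mdeg (exps K)) (F (exps K)) + e') * ?S \<le> (c * N K + e' * N K) * ?S"
          by (intro mult_right_mono sum_nonneg) auto
        with B(2)[OF K(1)[OF k that], of "\<lambda>I. z (I @ K)"] K(2)[OF k that]
        have "quad_form (tuples n (D - k)) (B (exps K)) (\<lambda>I. z (I @ K)) \<le> (c * N K + e' * N K) * ?S"
          by simp
        then show ?thesis using N[of K] by (simp add: divide_le_eq algebra_simps)
      qed
      then have "(\<Sum>K\<in>tuples n k. quad_form (tuples n (D - k)) (B (exps K)) (\<lambda>I. z (I @ K)) / N K) \<le>
          (\<Sum>K\<in>tuples n k. (c + e') * (\<Sum>I\<in>tuples n (D - k). (z (I @ K))\<^sup>2))"
        by (rule sum_mono)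
      \<comment> \<open>The slices over all tails partition the entries of \<open>z\<close>, so
        their squared norms add up to 1, however many blocks there are.\<close>
      also have "\<dots> = (c + e') * (\<Sum>I\<in>tuples n (D - k + k). (z I)\<^sup>2)"
        unfolding sum_tuples_append by (subst sum.swap) (simp add: sum_distrib_left)
      also have "\<dots> = c + e'"
        using z k by (simp add: L2_set_def real_sqrt_eq_1_iff)
      finally show ?thesis .
    qed
    then have "quad_form (tuples n D) M z \<le> (\<Sum>k\<le>D. c + e')"
      unfolding quad by (intro sum_mono) auto
    then show ?thesis by (simp add: algebra_simps)
  qed
  moreover obtain x where x: "L2_set x {..<n} = 1" using ex_unit_vector[OF n] by blast
  then have "\<exists>z. L2_set z (tuples n D) = 1" using L2_set_tensor_power[OF x] by blast
  ultimately have "(SUP z\<in>{z. L2_set z (tuples n D) = 1}. quad_form (tuples n D) M z) \<le> real (D + 1) * (c + e')"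
    by (intro cSUP_least) auto
  with Lam_le[OF n rep] have "Lam n d f \<le> real (D + 1) * (c + e')" by (simp add: D_def)
  also have "\<dots> = real (d div 2 + 1) * c + e"
    by (simp add: e'_def D_def distrib_left)
  finally show "Lam n d f \<le> real (d div 2 + 1) * c + e" .
qed

section \<open>Combination of the two bounds\<close>

theorem theorem5p4:
  "\<exists>C::nat. \<forall>(n::nat) (d::nat) (f::mpoly) (F::monom \<Rightarrow> mpoly).
     n > 0 \<longrightarrow> even d \<longrightarrow> homogeneous n d f \<longrightarrow> (\<forall>m. Poly_Mapping.lookup f m \<ge> 0) \<longrightarrow>
     multilinear_decomposition n d f F \<longrightarrow>
     Lam n d f / sphere_norm n f
       \<le> 2 ^ (C * d) *
         (MAX \<alpha>\<in>exponents n (d div 2). Lam n (d - 2 * mdeg \<alpha>) (F \<alpha>) / sphere_norm n (F \<alpha>))"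
proof (intro exI[of _ 3] allI impI)
  fix n d :: nat and f :: mpoly and F :: "monom \<Rightarrow> mpoly"
  assume n: "0 < n" and d: "even d" and f: "homogeneous n d f" "\<forall>m. 0 \<le> Poly_Mapping.lookup f m"
    and dec: "multilinear_decomposition n d f F"
  let ?q = "\<lambda>\<alpha>. Lam n (d - 2 * mdeg \<alpha>) (F \<alpha>) / sphere_norm n (F \<alpha>)"
  let ?N = "sphere_norm n f"
  define R where "R = (MAX \<alpha>\<in>exponents n (d div 2). ?q \<alpha>)"
  have nn: "nonneg_coeffs f" using f(2) by (simp add: nonneg_coeffs_def)
  have hom: "homogeneous n (d - 2 * mdeg a) (F a)" if "a \<in> exponents n (d div 2)" for a
    using dec that by (simp add: multilinear_decomposition_def)
  have ev: "even (d - 2 * mdeg a)" for a using d by simp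
  note nnF = nonneg_coeffs_decomposition[OF dec nn]
  have q: "?q a \<le> R" if "a \<in> exponents n (d div 2)" for a
    unfolding R_def using that by (intro Max_ge) auto
  \<comment> \<open>The term at the zero exponent vector already makes the maximum nonnegative;
    multiplying inequalities by \<open>R\<close> relies on it.\<close>
  have "0 \<le> ?q 0"
    using n hom[of 0] nnF[of 0] ev[of 0]
    by (intro divide_nonneg_nonneg Lam_nonneg sphere_norm_nonneg[of n "d - 2 * mdeg 0"]) auto
  also have "\<dots> \<le> R" by (rule q) simp
  finally have R: "0 \<le> R" .
  have N: "0 \<le> ?N" using sphere_norm_nonneg[OF n f(1)] .
  have part: "Lam n (d - 2 * mdeg a) (F a) \<le> (R * (4 ^ d * ?N)) * card (orderings a)"
    if a: "a \<in> exponents n (d div 2)" for a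
  proof -
    have "Lam n (d - 2 * mdeg a) (F a) \<le> R * sphere_norm n (F a)"
    \<comment> \<open>A quotient with denominator zero equals 0 and carries no information on
      \<open>Lam\<close>, hence the separate case.\<close>
    proof (cases "sphere_norm n (F a) = 0")
      case True
      then have "F a = 0" using sphere_norm_eq_0[OF n hom[OF a] nnF[OF a]] by simp
      then show ?thesis using Lam_zero[OF n ev] True by simp
    next
      case False
      then have "0 < sphere_norm n (F a)" using sphere_norm_nonneg[OF n hom[OF a]] by simp
      then show ?thesis using q[OF a] by (simp add: divide_le_eq)
    qed
    also have "\<dots> \<le> R * (4 ^ d * real (card (orderings a)) * ?N)"
      using sphere_norm_part_le[OF n f(1) nn dec a] R by (rule mult_left_mono)
    finally show ?thesis by (simp add: mult_ac)
  qed
  have "d div 2 + 1 \<le> 2 ^ d"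
    using less_le_trans[OF less_exp[of "d div 2"] power_increasing[of "d div 2" d "2::nat"]]
    by (simp add: Suc_le_eq)
  then have D: "real (d div 2 + 1) \<le> 2 ^ d"
    by (metis of_nat_le_iff of_nat_numeral of_nat_power)
  have "Lam n d f \<le> real (d div 2 + 1) * (R * (4 ^ d * ?N))"
    by (rule Lam_decomposition_le[OF n d dec part])
  also have "\<dots> \<le> 2 ^ d * (R * (4 ^ d * ?N))"
    using D R N by (intro mult_right_mono) auto
  \<comment> \<open>The constant 3 collects 2^d for the number of layers and 4^d from the norm
    comparison.\<close>
  also have "\<dots> = 2 ^ (3 * d) * R * ?N"
    by (simp add: power_mult power_mult_distrib[symmetric])
  finally have "Lam n d f \<le> 2 ^ (3 * d) * R * ?N" .
  \<comment> \<open>If the norm of \<open>f\<close> vanishes, the quotient is 0 by convention and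
    the right side is nonnegative.\<close>
  then have "Lam n d f / ?N \<le> 2 ^ (3 * d) * R"
    using N R by (cases "?N = 0") (auto simp: divide_le_eq)
  then show "Lam n d f / ?N \<le> 2 ^ (3 * d) * (MAX \<alpha>\<in>exponents n (d div 2). ?q \<alpha>)"
    by (simp add: R_def)
qed

end
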